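(* Let $c>0$ and $\Delta=(0,c]$. Let $F,G$ be distributions on $\mathbb R$ and $H=G*F\in\mathcal S_\Delta$, where $G(dx)=p_G\,\delta_0(dx)+(1-p_G)\,G_1(dx)$ with $p_G\in(2^{-1},1)$ and $G_1$ a distribution. Suppose that $H\in\mathcal D_\Delta$ or that $F,G,H$ are distributions on $\mathbb R_+=[0,\infty)$. Then $G(x+\Delta)=o(H(x+\Delta))$ as $x\to\infty$ implies $F\in\mathcal S_\Delta$, and indeed $H(x+\Delta)\sim F(x+\Delta)$.
   Context: $\delta_0$ is the Dirac measure at $0$. For $\Delta=(0,c]$ and a distribution $F$ on $\mathbb R$, $F(x+\Delta):=F((x,x+c])$. $F*G$ is the convolution and $F^{*n}$ the $n$-fold convolution. $\alpha(x)\sim\beta(x)$ means $\alpha(x)/\beta(x)\to1$ as $x\to\infty$. A non-negative measurable function $\alpha$ belongs to $\mathcal L$ if there is $x_0>0$ with $\alpha(x)>0$ for $x\ge x_0$ and, for every fixed $y>0$, $\alpha(x+y)\sim\alpha(x)$. $F\in\mathcal L_\Delta$ if $x\mapsto F(x+\Delta)$ is in $\mathcal L$; $F\in\mathcal S_\Delta$ if $F\in\mathcal L_\Delta$ and $F^{*2}(x+\Delta)\sim 2F(x+\Delta)$. A function $\alpha:\mathbb R\to\mathbb R_+$ is almost decreasing if there exist $x_0>0$ and $K>0$ such that $\alpha(x+y)\le K\alpha(x)$ for all $x>x_0$, $y>0$. $F\in\mathcal D_\Delta$ if $x\mapsto F(x+\Delta)$ is almost decreasing. *)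

theory Defs
  imports "HOL-Probability.Probability" "HOL-Library.Landau_Symbols"
begin

text \<open>
  Distributions on \<open>\<real>\<close> are measures satisfying \<^locale>\<open>real_distribution\<close>, and \<open>F * G\<close> is the library
  convolution \<open>F \<star> G\<close>. The relation \<open>\<sim>[at_top]\<close> is used for \<open>\<alpha>(x)/\<beta>(x) \<rightarrow> 1\<close>; the two
  differ only where both functions vanish, and wherever the relation occurs below, one of the two
  functions is already known to be positive for all large arguments.
\<close>

definition local_prob :: "real \<Rightarrow> real measure \<Rightarrow> real \<Rightarrow> real"
  where "local_prob c F x = measure F {x<..x + c}"

definition long_tailed_fun :: "(real \<Rightarrow> real) \<Rightarrow> bool"
  where "long_tailed_fun \<alpha> \<longleftrightarrow>
    \<alpha> \<in> borel_measurable borel \<and> (\<forall>x. 0 \<le> \<alpha> x) \<and>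
    (\<exists>x0>0. \<forall>x\<ge>x0. 0 < \<alpha> x) \<and>
    (\<forall>y>0. (\<lambda>x. \<alpha> (x + y)) \<sim>[at_top] \<alpha>)"

definition almost_decreasing :: "(real \<Rightarrow> real) \<Rightarrow> bool"
  where "almost_decreasing \<alpha> \<longleftrightarrow>
    (\<forall>x. 0 \<le> \<alpha> x) \<and> (\<exists>x0>0. \<exists>K>0. \<forall>x>x0. \<forall>y>0. \<alpha> (x + y) \<le> K * \<alpha> x)"

definition L_Delta :: "real \<Rightarrow> real measure set"
  where "L_Delta c = {F. real_distribution F \<and> long_tailed_fun (local_prob c F)}"

definition S_Delta :: "real \<Rightarrow> real measure set"
  where "S_Delta c =
    {F \<in> L_Delta c. local_prob c (F \<star> F) \<sim>[at_top] (\<lambda>x. 2 * local_prob c F x)}"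

definition D_Delta :: "real \<Rightarrow> real measure set"
  where "D_Delta c = {F. real_distribution F \<and> almost_decreasing (local_prob c F)}"

end

theory Submission
  imports Defs
begin

text \<open>
  Write \<open>f(x) = F(x + \<Delta>)\<close>, \<open>h(x) = H(x + \<Delta>)\<close>, \<open>p = p\<^sub>G\<close> and \<open>q = 1 - p < p\<close>. The form of \<open>G\<close> gives
  \<open>h = p * f + q * k\<close>, where \<open>k(x) = (G\<^sub>1 \<star> F)(x + \<Delta>) = \<integral> f(x - y) G\<^sub>1(dy)\<close>. In particular \<open>F\<close> is
  dominated by \<open>H / p\<close>, and \<open>f / h - 1 = (q / p) * (1 - k / h)\<close>.

  Up to a negligible relative error, \<open>k(x) / h(x)\<close> is an average of the values of \<open>f / h\<close> near \<open>x\<close>,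
  so an eventual bound \<open>D\<close> for \<open>\<bar>f / h - 1\<bar>\<close> is also one for \<open>\<bar>k / h - 1\<bar>\<close>
  (lemma \<open>convolution_relative_error\<close>), and the identity above improves it to \<open>(q / p) * D\<close>.
  As \<open>f / h\<close> is bounded and \<open>q / p < 1\<close>, iteration yields \<open>f / h \<rightarrow> 1\<close>
  (lemma \<open>tendsto_zero_of_contraction\<close>). The ratio \<open>q / p\<close> is less than one exactly
  because \<open>p > 1 / 2\<close>.

  The averaging claim needs \<open>\<integral> h(x - y) G\<^sub>1(dy)\<close> over \<open>\<bar>y\<bar> > A\<close> to be small relative to \<open>h(x)\<close>. For
  \<open>y > A\<close>, the measure \<open>G\<^sub>1\<close> is a small multiple of \<open>H\<close> on windows of length \<open>c\<close>, so a comparison on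
  cells (lemma \<open>cell_comparison\<close>) reduces the integral to a small multiple of \<open>H \<star> H\<close> near \<open>x\<close>, which
  is of order \<open>h(x)\<close> because \<open>H\<close> is subexponential. For \<open>y < -A\<close> the arguments \<open>x - y\<close> exceed \<open>x\<close>,
  and either \<open>h\<close> is almost decreasing or \<open>G\<^sub>1\<close> has no mass there.

  Finally, subexponentiality passes from \<open>H\<close> to \<open>F\<close> (lemma \<open>S_Delta_asymp_equiv\<close>): a sum of two
  independent variables that is large has one moderate summand, which accounts for
  \<open>2 * f(x)\<close>, or two large ones, and the latter event is negligible for \<open>H\<close> and hence for
  the dominated \<open>F\<close>.
\<close>

section \<open>Local probabilities and convolutions\<close>

lemma local_prob_nonneg: "0 \<le> local_prob c F x"
  by (simp add: local_prob_def)

lemma local_prob_measurable: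
  assumes "real_distribution F" and "0 < c"
  shows "local_prob c F \<in> borel_measurable borel"
proof -
  interpret F: real_distribution F by fact
  have cdf[measurable]: "cdf F \<in> borel_measurable borel"
    by (rule borel_measurable_mono) (auto simp: mono_def intro: F.cdf_nondecreasing)
  have "local_prob c F = (\<lambda>x. cdf F (x + c) - cdf F x)"
    using \<open>0 < c\<close> by (auto simp: local_prob_def F.cdf_diff_eq)
  then show ?thesis by simp
qed

lemma local_prob_le_1: "real_distribution F \<Longrightarrow> local_prob c F x \<le> 1"
  unfolding local_prob_def by (simp add: real_distribution.axioms(1) prob_space.prob_le_1)

lemma local_prob_add:
  assumes "real_distribution F" "0 \<le> a" "0 \<le> b"
  shows "local_prob (a + b) F x = local_prob a F x + local_prob b F (x + a)"
proof -
  interpret F: real_distribution F by fact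
  have "{x<..x + (a + b)} = {x<..x + a} \<union> {x + a<..x + a + b}"
    using assms by auto
  then show ?thesis
    unfolding local_prob_def by (simp add: F.finite_measure_Union)
qed

lemma local_prob_mono:
  assumes "real_distribution F" and "y \<le> x" and "x + a \<le> y + b"
  shows "local_prob a F x \<le> local_prob b F y"
proof -
  interpret F: real_distribution F by fact
  show ?thesis
    unfolding local_prob_def using assms(2,3) by (intro F.finite_measure_mono) auto
qed

lemma set_integrable_local_prob:
  assumes "real_distribution M" "real_distribution N" "0 < c" "S \<in> sets borel"
  shows "set_integrable M S (\<lambda>y. local_prob c N (x - y))"
proof -
  interpret M: real_distribution M by fact
  have [measurable]: "local_prob c N \<in> borel_measurable borel"
    using assms by (intro local_prob_measurable)
  show ?thesis
    unfolding set_integrable_def using assms(2,4)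
    by (intro M.integrable_const_bound[where B=1])
       (auto simp: local_prob_nonneg local_prob_le_1 indicator_def)
qed

text \<open>
  Fubini's theorem, with the set \<open>S\<close> recording where the first summand lies. Taking \<open>S\<close> to be
  everything gives the convolution formula; other choices of \<open>S\<close> split a convolution according
  to the size of one summand.
\<close>
lemma measure_strip:
  assumes "real_distribution M" "real_distribution N" "0 < c" "S \<in> sets borel"
  shows "measure (M \<Otimes>\<^sub>M N) {(u, v). u \<in> S \<and> u + v \<in> {x<..x + c}} =
         (LINT y:S|M. local_prob c N (x - y))"
proof -
  interpret M: real_distribution M by fact
  interpret N: real_distribution N by fact
  interpret MN: pair_prob_space M N ..
  have [measurable]: "S \<in> sets borel" by fact
  have [measurable]: "local_prob c N \<in> borel_measurable borel"
    using assms by (intro local_prob_measurable)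
  let ?Z = "{(u, v). u \<in> S \<and> u + v \<in> {x<..x + c}}"
  have sp: "space (M \<Otimes>\<^sub>M N) = UNIV" by (simp add: space_pair_measure)
  have "{z \<in> space (M \<Otimes>\<^sub>M N). fst z \<in> S \<and> fst z + snd z \<in> {x<..x + c}} \<in> sets (M \<Otimes>\<^sub>M N)"
    by measurable
  then have Z: "?Z \<in> sets (M \<Otimes>\<^sub>M N)"
    by (simp add: sp case_prod_unfold)
  have sec: "emeasure N (Pair y -` ?Z) = ennreal (indicator S y * local_prob c N (x - y))" for y
  proof (cases "y \<in> S")
    case True
    then have "Pair y -` ?Z = {x - y<..x - y + c}" by auto
    with True show ?thesis by (simp add: local_prob_def N.emeasure_eq_measure)
  qed simp
  have "emeasure (M \<Otimes>\<^sub>M N) ?Z = (\<integral>\<^sup>+y. ennreal (indicator S y * local_prob c N (x - y)) \<partial>M)"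
    by (subst N.emeasure_pair_measure_alt[OF Z]) (simp only: sec)
  then have "measure (M \<Otimes>\<^sub>M N) ?Z = enn2real (\<integral>\<^sup>+y. ennreal (indicator S y * local_prob c N (x - y)) \<partial>M)"
    by (simp add: measure_def)
  also have "\<dots> = (LINT y|M. indicator S y * local_prob c N (x - y))"
    by (subst integral_eq_nn_integral) (auto simp: local_prob_nonneg)
  finally show ?thesis by (simp add: set_lebesgue_integral_def)
qed

lemma real_distribution_convolution:
  assumes "real_distribution M" "real_distribution N"
  shows "real_distribution (M \<star> N)"
proof -
  interpret M: real_distribution M by fact
  interpret N: real_distribution N by fact
  interpret MN: pair_prob_space M N ..
  have "prob_space (M \<star> N)"
    unfolding convolution_def by (intro MN.prob_space_distr) measurable
  then show ?thesis
    by (simp add: real_distribution_def real_distribution_axioms_def)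
qed

lemma local_prob_convolution_strip:
  assumes "real_distribution M" "real_distribution N"
  shows "local_prob c (M \<star> N) x = measure (M \<Otimes>\<^sub>M N) {(u, v). u + v \<in> {x<..x + c}}"
proof -
  interpret M: real_distribution M by fact
  interpret N: real_distribution N by fact
  have "(\<lambda>(u, v). u + v) -` {x<..x + c} \<inter> space (M \<Otimes>\<^sub>M N) = {(u, v). u + v \<in> {x<..x + c}}"
    by (auto simp: space_pair_measure)
  moreover have "(\<lambda>(u, v). u + v) \<in> measurable (M \<Otimes>\<^sub>M N) borel" by measurable
  ultimately show ?thesis
    unfolding local_prob_def convolution_def by (simp add: measure_distr)
qed

lemma local_prob_convolution:
  assumes "real_distribution M" "real_distribution N" "0 < c"
  shows "local_prob c (M \<star> N) x = (LINT y:UNIV|M. local_prob c N (x - y))"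
  using measure_strip[OF assms, of UNIV x] assms by (simp add: local_prob_convolution_strip)

section \<open>Contribution of moderate summands\<close>

lemma filterlim_add_const_at_top: "filterlim (\<lambda>x. x + d) at_top at_top" for d :: real
  by (subst add.commute) (rule filterlim_tendsto_add_at_top[OF tendsto_const filterlim_ident])

text \<open>
  Substituting \<open>x - y\<close> for \<open>x\<close> extends the defining property to shifts of either sign.
\<close>
lemma long_tailed_shift:
  assumes "long_tailed_fun \<alpha>"
  shows "((\<lambda>x. \<alpha> (x + y) / \<alpha> x) \<longlongrightarrow> 1) at_top"
proof -
  obtain x0 where pos: "\<And>x. x0 \<le> x \<Longrightarrow> 0 < \<alpha> x"
    using assms unfolding long_tailed_fun_def by blast
  have up: "((\<lambda>x. \<alpha> (x + y) / \<alpha> x) \<longlongrightarrow> 1) at_top" if "0 < y" for y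
  proof (rule Lim_transform_eventually)
    show "((\<lambda>x. if \<alpha> (x + y) = 0 \<and> \<alpha> x = 0 then 1 else \<alpha> (x + y) / \<alpha> x) \<longlongrightarrow> 1) at_top"
      using assms that by (simp add: long_tailed_fun_def asymp_equiv_def)
    show "\<forall>\<^sub>F x in at_top. (if \<alpha> (x + y) = 0 \<and> \<alpha> x = 0 then 1 else \<alpha> (x + y) / \<alpha> x) = \<alpha> (x + y) / \<alpha> x"
      using eventually_ge_at_top[of x0] by eventually_elim (use pos in force)
  qed
  consider "0 < y" | "y = 0" | "y < 0" by linarith
  then show ?thesis
  proof cases
    case 2
    have "\<forall>\<^sub>F x in at_top. 1 = \<alpha> (x + y) / \<alpha> x"
      using eventually_ge_at_top[of x0] by eventually_elim (use pos 2 in force)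
    then show ?thesis by (rule Lim_transform_eventually[OF tendsto_const])
  next
    case 3
    have "((\<lambda>x. inverse (\<alpha> (x + y + - y) / \<alpha> (x + y))) \<longlongrightarrow> inverse 1) at_top"
      using 3 by (intro tendsto_inverse filterlim_compose[OF up filterlim_add_const_at_top]) auto
    then show ?thesis by simp
  qed (rule up)
qed

text \<open>
  When the summand with law \<open>M\<close> stays within \<open>[-A, A]\<close>, long-tailedness lets the shift \<open>x - y\<close> be
  replaced by \<open>x\<close>. This is dominated convergence. The domination uses the special form of the
  function: every window \<open>(x - y, x - y + c]\<close> with \<open>\<bar>y\<bar> \<le> A\<close> is covered by a fixed number of shifted
  windows of length \<open>c\<close>, and each of them has asymptotically the same mass as \<open>(x, x + c]\<close>.
\<close>
lemma central_integral_tendsto: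
  assumes "real_distribution M" "real_distribution N" "0 < c" "long_tailed_fun (local_prob c N)"
  shows "((\<lambda>x. (LINT y:{-A..A}|M. local_prob c N (x - y)) / local_prob c N x) \<longlongrightarrow> measure M {-A..A}) at_top"
proof -
  interpret M: real_distribution M by fact
  let ?h = "local_prob c N"
  let ?s = "\<lambda>x y. indicator {-A..A} y * (?h (x - y) / ?h x)"
  have [measurable]: "?h \<in> borel_measurable borel"
    using assms by (intro local_prob_measurable)
  have shift: "((\<lambda>x. ?h (x + y) / ?h x) \<longlongrightarrow> 1) at_top" for y
    by (rule long_tailed_shift) fact
  obtain J :: nat where J: "\<bar>A\<bar> \<le> real J * c"
    using \<open>0 < c\<close> by (metis reals_Archimedean3 less_imp_le)
  \<comment> \<open>The numerator is the mass of a window of length \<open>(2 * J + 1) * c\<close> that contains all the windows \<open>(x - y, x - y + c]\<close>.\<close>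
  let ?w = "\<lambda>x. local_prob (2 * real J * c + c) N (x - real J * c) / ?h x"
  have cells: "local_prob (real n * c) N z = (\<Sum>i<n. ?h (z + real i * c))" for n z
  proof (induction n)
    case (Suc n)
    have "local_prob (real (Suc n) * c) N z = local_prob (real n * c + c) N z"
      by (simp add: algebra_simps)
    then show ?case
      using Suc \<open>0 < c\<close> assms by (simp add: local_prob_add)
  qed (simp add: local_prob_def)
  have "((\<lambda>x. \<Sum>i<2*J+1. ?h (x + (real i * c - real J * c)) / ?h x) \<longlongrightarrow> (\<Sum>i<2*J+1. 1)) at_top"
    by (intro tendsto_sum shift)
  moreover have "?w x = (\<Sum>i<2*J+1. ?h (x + (real i * c - real J * c)) / ?h x)" for x
    using cells[of "2*J+1" "x - real J * c"]
    by (simp add: algebra_simps sum_divide_distrib add_divide_distrib)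
  ultimately have "(?w \<longlongrightarrow> real (2*J+1)) at_top" by simp
  then have wb: "\<forall>\<^sub>F x in at_top. ?w x < real (2*J+1) + 1"
    by (rule order_tendstoD) simp
  have "((\<lambda>x. LINT y|M. ?s x y) \<longlongrightarrow> (LINT y|M. indicator {-A..A} y)) at_top"
  proof (rule integral_dominated_convergence_at_top[where w="\<lambda>_. real (2*J+1) + 1"])
    show "\<forall>\<^sub>F x in at_top. AE y in M. norm (?s x y) \<le> real (2*J+1) + 1"
      using wb
    proof eventually_elim
      case (elim x)
      have "norm (?s x y) \<le> ?w x" for y
      proof (cases "y \<in> {-A..A}")
        case True
        then have "?h (x - y) \<le> local_prob (2 * real J * c + c) N (x - real J * c)"
          using J \<open>0 < c\<close> by (intro local_prob_mono assms) (auto simp: algebra_simps)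
        then show ?thesis using True by (simp add: local_prob_nonneg divide_right_mono)
      qed (simp add: local_prob_nonneg)
      then show ?case using elim by (intro AE_I2) (meson less_imp_le order_trans)
    qed
    show "AE y in M. ((\<lambda>x. ?s x y) \<longlongrightarrow> indicator {-A..A} y) at_top"
    proof (intro AE_I2)
      fix y show "((\<lambda>x. ?s x y) \<longlongrightarrow> indicator {-A..A} y) at_top"
        using tendsto_mult[OF tendsto_const shift[of "-y"], of "indicator {-A..A} y"] by simp
    qed
  qed (simp_all)
  then show ?thesis
    by (simp add: set_lebesgue_integral_def)
qed

section \<open>Comparing two measures on cells of fixed length\<close>

text \<open>
  Domination of \<open>M\<close> by \<open>\<epsilon> * N\<close> is known only on windows of length \<open>c\<close>, not on all Borel sets, so
  the integrand has to be made constant on such windows. Cut \<open>(A, \<infinity>)\<close> into the cells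
  \<open>(t k, t k + c]\<close>. For \<open>y\<close> in the \<open>k\<close>-th cell the window \<open>(x - y, x - y + c]\<close> lies in
  \<open>(x - t k - c, x - t k + c]\<close>, whose mass \<open>J k\<close> depends on \<open>k\<close> alone, so \<open>M\<close> may be exchanged for
  \<open>\<epsilon> * N\<close> there. The larger window lies in turn in \<open>(x - c - y, x + 2 * c - y]\<close> for every \<open>y\<close> in the
  cell, which leads back to a convolution, now over a window of length \<open>3 * c\<close>.
\<close>
lemma cell_comparison:
  assumes "real_distribution M" "real_distribution N" "real_distribution H" "0 < c" "0 \<le> \<epsilon>"
    and dom: "\<And>t. A \<le> t \<Longrightarrow> local_prob c M t \<le> \<epsilon> * local_prob c N t"
  shows "(LINT y:{A<..}|M. local_prob c H (x - y)) \<le> \<epsilon> * local_prob (3 * c) (N \<star> H) (x - c)"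
proof -
  interpret M: real_distribution M by fact
  interpret N: real_distribution N by fact
  interpret H: real_distribution H by fact
  have [measurable]: "local_prob c H \<in> borel_measurable borel" "local_prob (3 * c) H \<in> borel_measurable borel"
    using assms by (auto intro!: local_prob_measurable)
  define t where "t k = A + real k * c" for k
  define cell where "cell k = {t k<..t k + c}" for k
  define J where "J k = local_prob (2 * c) H (x - t k - c)" for k
  have cellD: "t k < y" "y \<le> t k + c" if "y \<in> cell k" for k y
    using that by (auto simp: cell_def)
  have [measurable]: "cell k \<in> sets borel" for k by (simp add: cell_def)
  have disj: "disjoint_family cell"
    unfolding disjoint_family_on_def
  proof (intro ballI impI)
    fix m n :: nat assume "m \<noteq> n"
    have "cell i \<inter> cell j = {}" if "i < j" for i j
    proof -
      have "(real i + 1) * c \<le> real j * c"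
        using that \<open>0 < c\<close> by (intro mult_right_mono) auto
      then show ?thesis by (auto simp: cell_def t_def algebra_simps)
    qed
    then show "cell m \<inter> cell n = {}"
      using \<open>m \<noteq> n\<close> by (metis Int_commute nat_neq_iff)
  qed
  have un: "(\<Union>k. cell k) = {A<..}"
  proof (intro equalityI subsetI)
    fix y assume "y \<in> (\<Union>k. cell k)"
    then obtain k where "A + real k * c < y" by (auto simp: cell_def t_def)
    moreover have "0 \<le> real k * c" using \<open>0 < c\<close> by simp
    ultimately show "y \<in> {A<..}" by simp
  next
    fix y assume y: "y \<in> {A<..}"
    define z where "z = (y - A) / c"
    have "0 < z" using y \<open>0 < c\<close> by (simp add: z_def)
    define k where "k = nat (\<lceil>z\<rceil> - 1)"
    have "real k = of_int \<lceil>z\<rceil> - 1"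
      using \<open>0 < z\<close> by (simp add: k_def)
    then have "real k < z" "z \<le> real k + 1" by linarith+
    then have "real k * c < y - A" "y - A \<le> (real k + 1) * c"
      using \<open>0 < c\<close> by (simp_all add: z_def field_simps)
    then have "y \<in> cell k" by (simp add: cell_def t_def algebra_simps)
    then show "y \<in> (\<Union>k. cell k)" by blast
  qed
  have le1: "local_prob c H (x - y) \<le> J k" if "y \<in> cell k" for y k
    unfolding J_def using cellD[OF that] by (intro local_prob_mono assms) auto
  have le2: "J k \<le> local_prob (3 * c) H (x - c - y)" if "y \<in> cell k" for y k
    unfolding J_def using cellD[OF that] by (intro local_prob_mono assms) auto
  have cm: "emeasure M (cell k) \<le> ennreal \<epsilon> * emeasure N (cell k)" for k
  proof -
    have "A \<le> t k" using \<open>0 < c\<close> by (simp add: t_def)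
    from dom[OF this] show ?thesis
      using \<open>0 \<le> \<epsilon>\<close> by (simp add: cell_def local_prob_def M.emeasure_eq_measure N.emeasure_eq_measure
          flip: ennreal_mult)
  qed
  have "(\<integral>\<^sup>+y\<in>{A<..}. ennreal (local_prob c H (x - y)) \<partial>M)
      = (\<Sum>k. \<integral>\<^sup>+y\<in>cell k. ennreal (local_prob c H (x - y)) \<partial>M)"
    unfolding un[symmetric] by (rule nn_integral_disjoint_family[OF _ _ disj]) auto
  also have "\<dots> \<le> (\<Sum>k. ennreal \<epsilon> * (\<integral>\<^sup>+y\<in>cell k. ennreal (local_prob (3 * c) H (x - c - y)) \<partial>N))"
  proof (rule suminf_le)
    fix k
    have "(\<integral>\<^sup>+y\<in>cell k. ennreal (local_prob c H (x - y)) \<partial>M) \<le> (\<integral>\<^sup>+y. ennreal (J k) * indicator (cell k) y \<partial>M)"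
      by (intro nn_integral_mono) (auto simp: indicator_def intro!: ennreal_leI le1)
    also have "\<dots> = ennreal (J k) * emeasure M (cell k)" by (simp add: nn_integral_cmult_indicator)
    also have "\<dots> \<le> ennreal (J k) * (ennreal \<epsilon> * emeasure N (cell k))"
      by (intro mult_left_mono cm) auto
    also have "\<dots> = ennreal \<epsilon> * (\<integral>\<^sup>+y. ennreal (J k) * indicator (cell k) y \<partial>N)"
      by (simp add: nn_integral_cmult_indicator mult_ac)
    also have "\<dots> \<le> ennreal \<epsilon> * (\<integral>\<^sup>+y\<in>cell k. ennreal (local_prob (3 * c) H (x - c - y)) \<partial>N)"
      by (intro mult_left_mono nn_integral_mono) (auto simp: indicator_def intro!: ennreal_leI le2)
    finally show "(\<integral>\<^sup>+y\<in>cell k. ennreal (local_prob c H (x - y)) \<partial>M)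
       \<le> ennreal \<epsilon> * (\<integral>\<^sup>+y\<in>cell k. ennreal (local_prob (3 * c) H (x - c - y)) \<partial>N)" .
  qed auto
  also have "\<dots> = ennreal \<epsilon> * (\<Sum>k. \<integral>\<^sup>+y\<in>cell k. ennreal (local_prob (3 * c) H (x - c - y)) \<partial>N)"
    by simp
  also have "(\<Sum>k. \<integral>\<^sup>+y\<in>cell k. ennreal (local_prob (3 * c) H (x - c - y)) \<partial>N)
      = (\<integral>\<^sup>+y\<in>{A<..}. ennreal (local_prob (3 * c) H (x - c - y)) \<partial>N)"
    unfolding un[symmetric] by (rule nn_integral_disjoint_family[OF _ _ disj, symmetric]) auto
  also have "\<dots> \<le> (\<integral>\<^sup>+y. ennreal (local_prob (3 * c) H (x - c - y)) \<partial>N)"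
    by (intro nn_integral_mono) (auto simp: indicator_def)
  also have "\<dots> = ennreal (local_prob (3 * c) (N \<star> H) (x - c))"
    using set_integrable_local_prob[OF assms(2,3), of "3*c" UNIV "x - c"] assms
    by (subst nn_integral_eq_integral)
       (auto simp: local_prob_nonneg set_integrable_def local_prob_convolution set_lebesgue_integral_def)
  finally have *: "(\<integral>\<^sup>+y\<in>{A<..}. ennreal (local_prob c H (x - y)) \<partial>M)
      \<le> ennreal \<epsilon> * ennreal (local_prob (3 * c) (N \<star> H) (x - c))"
    by (simp add: mult_left_mono)
  have "(\<integral>\<^sup>+y\<in>{A<..}. ennreal (local_prob c H (x - y)) \<partial>M)
      = (\<integral>\<^sup>+y. ennreal (indicator {A<..} y * local_prob c H (x - y)) \<partial>M)"
    by (intro nn_integral_cong) (auto simp: indicator_def)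
  also have "\<dots> = ennreal (LINT y:{A<..}|M. local_prob c H (x - y))"
    using set_integrable_local_prob[OF assms(1,3,4), of "{A<..}" x]
    by (subst nn_integral_eq_integral)
       (auto simp: local_prob_nonneg set_integrable_def set_lebesgue_integral_def)
  finally show ?thesis
    using * \<open>0 \<le> \<epsilon>\<close> by (simp add: local_prob_nonneg flip: ennreal_mult)
qed

section \<open>Subexponentiality passes to asymptotically equivalent dominated distributions\<close>

definition far_part :: "real \<Rightarrow> real \<Rightarrow> real measure \<Rightarrow> real \<Rightarrow> real"
  where "far_part c A F x =
    measure (F \<Otimes>\<^sub>M F) {(u, v). A < \<bar>u\<bar> \<and> A < \<bar>v\<bar> \<and> u + v \<in> {x<..x + c}}"

lemma far_part_nonneg: "0 \<le> far_part c A F x"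
  by (simp add: far_part_def)

text \<open>
  Two summands that both lie in \<open>[-A, A]\<close> cannot have a sum above \<open>2 * A\<close>, so exactly one summand
  is moderate or both are large; the two cases with a moderate summand are equal by symmetry.
\<close>
lemma convolution_square_split:
  assumes "real_distribution F" "0 < c" "2 * A \<le> x"
  shows "local_prob c (F \<star> F) x = 2 * (LINT y:{-A..A}|F. local_prob c F (x - y)) + far_part c A F x"
proof -
  interpret F: real_distribution F by fact
  interpret FF: pair_prob_space F F ..
  have sp: "space (F \<Otimes>\<^sub>M F) = UNIV" by (simp add: space_pair_measure)
  let ?P = "F \<Otimes>\<^sub>M F"
  let ?Z1 = "{(u, v). u \<in> {-A..A} \<and> u + v \<in> {x<..x + c}}"
  let ?Z2 = "{(u, v). v \<in> {-A..A} \<and> u + v \<in> {x<..x + c}}"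
  let ?Z3 = "{(u, v). A < \<bar>u\<bar> \<and> A < \<bar>v\<bar> \<and> u + v \<in> {x<..x + c}}"
  have "{z \<in> space ?P. fst z \<in> {-A..A} \<and> fst z + snd z \<in> {x<..x + c}} \<in> sets ?P"
    and "{z \<in> space ?P. snd z \<in> {-A..A} \<and> fst z + snd z \<in> {x<..x + c}} \<in> sets ?P"
    and "{z \<in> space ?P. A < \<bar>fst z\<bar> \<and> A < \<bar>snd z\<bar> \<and> fst z + snd z \<in> {x<..x + c}} \<in> sets ?P"
    by measurable
  then have m: "?Z1 \<in> sets ?P" "?Z2 \<in> sets ?P" "?Z3 \<in> sets ?P"
    by (simp_all add: sp case_prod_unfold)
  have "measure ?P ?Z2 = measure (distr ?P ?P (\<lambda>(u, v). (v, u))) ?Z2"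
    by (simp flip: FF.distr_pair_swap)
  also have "\<dots> = measure ?P ((\<lambda>(u, v). (v, u)) -` ?Z2 \<inter> space ?P)"
    using m by (intro measure_distr) auto
  also have "(\<lambda>(u, v). (v, u)) -` ?Z2 \<inter> space ?P = ?Z1"
    by (auto simp: sp add.commute)
  finally have swap: "measure ?P ?Z2 = measure ?P ?Z1" .
  have "{(u, v). u + v \<in> {x<..x + c}} = (?Z1 \<union> ?Z2) \<union> ?Z3" by auto
  moreover have "?Z1 \<inter> ?Z2 = {}" "(?Z1 \<union> ?Z2) \<inter> ?Z3 = {}" using assms(3) by auto
  ultimately have "local_prob c (F \<star> F) x = measure ?P ?Z1 + measure ?P ?Z2 + measure ?P ?Z3"
    using m by (simp add: local_prob_convolution_strip assms FF.P.finite_measure_Union)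
  then show ?thesis
    using swap measure_strip[OF assms(1,1,2), of "{-A..A}" x] by (simp add: far_part_def)
qed

lemma far_part_mono:
  assumes "real_distribution F" "real_distribution H" "0 \<le> C"
    and le: "\<And>B. B \<in> sets borel \<Longrightarrow> measure F B \<le> C * measure H B"
  shows "far_part c A F x \<le> C\<^sup>2 * far_part c A H x"
proof -
  interpret F: real_distribution F by fact
  interpret H: real_distribution H by fact
  interpret FF: pair_prob_space F F ..
  interpret HH: pair_prob_space H H ..
  let ?Z = "{(u, v). A < \<bar>u\<bar> \<and> A < \<bar>v\<bar> \<and> u + v \<in> {x<..x + c}}"
  have "{z \<in> space (F \<Otimes>\<^sub>M F). A < \<bar>fst z\<bar> \<and> A < \<bar>snd z\<bar> \<and> fst z + snd z \<in> {x<..x + c}} \<in> sets (F \<Otimes>\<^sub>M F)"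
    by measurable
  then have mF: "?Z \<in> sets (F \<Otimes>\<^sub>M F)"
    by (simp add: space_pair_measure case_prod_unfold)
  have "{z \<in> space (H \<Otimes>\<^sub>M H). A < \<bar>fst z\<bar> \<and> A < \<bar>snd z\<bar> \<and> fst z + snd z \<in> {x<..x + c}} \<in> sets (H \<Otimes>\<^sub>M H)"
    by measurable
  then have mH: "?Z \<in> sets (H \<Otimes>\<^sub>M H)"
    by (simp add: space_pair_measure case_prod_unfold)
  have ele: "emeasure F B \<le> ennreal C * emeasure H B" if "B \<in> sets borel" for B
    using le[OF that] \<open>0 \<le> C\<close> by (simp add: F.emeasure_eq_measure H.emeasure_eq_measure flip: ennreal_mult)
  have "F \<le> scale_measure (ennreal C) H"
    by (subst le_measure) (auto simp: le_fun_def ele)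
  then have int: "(\<integral>\<^sup>+u. \<phi> u \<partial>F) \<le> ennreal C * (\<integral>\<^sup>+u. \<phi> u \<partial>H)" if "\<phi> \<in> borel_measurable borel" for \<phi>
    using that by (subst nn_integral_scale_measure[symmetric]) (auto intro!: nn_integral_mono_measure)
  have sec: "Pair u -` ?Z \<in> sets borel" for u
    using sets_Pair1[OF mF] by simp
  have [measurable]: "(\<lambda>u. emeasure H (Pair u -` ?Z)) \<in> borel_measurable borel"
    using H.measurable_emeasure_Pair[OF mH] by simp
  have "emeasure (F \<Otimes>\<^sub>M F) ?Z = (\<integral>\<^sup>+u. emeasure F (Pair u -` ?Z) \<partial>F)"
    by (rule F.emeasure_pair_measure_alt[OF mF])
  also have "\<dots> \<le> (\<integral>\<^sup>+u. ennreal C * emeasure H (Pair u -` ?Z) \<partial>F)"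
    by (intro nn_integral_mono ele sec)
  also have "\<dots> \<le> ennreal C * (\<integral>\<^sup>+u. ennreal C * emeasure H (Pair u -` ?Z) \<partial>H)"
    by (rule int) measurable
  also have "\<dots> = ennreal C * (ennreal C * (\<integral>\<^sup>+u. emeasure H (Pair u -` ?Z) \<partial>H))"
    by (subst nn_integral_cmult) simp_all
  also have "(\<integral>\<^sup>+u. emeasure H (Pair u -` ?Z) \<partial>H) = emeasure (H \<Otimes>\<^sub>M H) ?Z"
    by (rule H.emeasure_pair_measure_alt[OF mH, symmetric])
  finally have "ennreal (far_part c A F x) \<le> ennreal C * (ennreal C * ennreal (far_part c A H x))"
    by (simp add: far_part_def FF.P.emeasure_eq_measure HH.P.emeasure_eq_measure)
  then show ?thesis
    using \<open>0 \<le> C\<close> by (simp add: far_part_nonneg power2_eq_square mult.assoc flip: ennreal_mult)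
qed

lemma eventually_central_mass:
  assumes "real_distribution M" "\<epsilon> > 0"
  shows "\<forall>\<^sub>F A in at_top. 1 - \<epsilon> < measure M {-A..A}"
proof -
  interpret M: real_distribution M by fact
  have "((\<lambda>A. cdf M A - cdf M (- A)) \<longlongrightarrow> 1 - 0) at_top"
    by (intro tendsto_diff M.cdf_lim_at_top_prob filterlim_compose[OF M.cdf_lim_at_bot filterlim_uminus_at_bot_at_top])
  then have "\<forall>\<^sub>F A in at_top. 1 - \<epsilon> < cdf M A - cdf M (- A)"
    using assms(2) by (intro order_tendstoD) auto
  then show ?thesis
    using eventually_gt_at_top[of 0]
  proof eventually_elim
    case (elim A)
    have "cdf M A - cdf M (- A) = measure M {-A<..A}"
      using elim by (intro M.cdf_diff_eq) auto
    also have "\<dots> \<le> measure M {-A..A}"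
      by (intro M.finite_measure_mono) auto
    finally show ?case using elim by simp
  qed
qed

lemma asymp_equiv_ratio:
  fixes \<alpha> \<beta> :: "real \<Rightarrow> real"
  assumes "\<alpha> \<sim>[at_top] \<beta>" "\<forall>\<^sub>F x in at_top. 0 < \<beta> x"
  shows "((\<lambda>x. \<alpha> x / \<beta> x) \<longlongrightarrow> 1) at_top"
  by (rule asymp_equivD_strong[OF assms(1)]) (use assms(2) in eventually_elim, auto)

lemma long_tailed_eventually_pos: "long_tailed_fun \<alpha> \<Longrightarrow> \<forall>\<^sub>F x in at_top. 0 < \<alpha> x"
  unfolding long_tailed_fun_def eventually_at_top_linorder by blast

lemma S_DeltaD:
  assumes "F \<in> S_Delta c"
  shows "real_distribution F" "long_tailed_fun (local_prob c F)"
    and "((\<lambda>x. local_prob c (F \<star> F) x / local_prob c F x) \<longlongrightarrow> 2) at_top"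
proof -
  show "real_distribution F" and l: "long_tailed_fun (local_prob c F)"
    using assms by (auto simp: S_Delta_def L_Delta_def)
  have "((\<lambda>x. local_prob c (F \<star> F) x / (2 * local_prob c F x)) \<longlongrightarrow> 1) at_top"
    using assms long_tailed_eventually_pos[OF l] by (intro asymp_equiv_ratio) (auto simp: S_Delta_def)
  from tendsto_mult_left[OF this, of 2]
  show "((\<lambda>x. local_prob c (F \<star> F) x / local_prob c F x) \<longlongrightarrow> 2) at_top" by simp
qed

lemma long_tailed_asymp_equiv:
  assumes "long_tailed_fun \<beta>" "\<alpha> \<in> borel_measurable borel" "\<And>x. 0 \<le> \<alpha> x" "\<alpha> \<sim>[at_top] \<beta>"
  shows "long_tailed_fun \<alpha>"
proof -
  have "((\<lambda>x. \<alpha> x / \<beta> x) \<longlongrightarrow> 1) at_top"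
    by (intro asymp_equiv_ratio assms long_tailed_eventually_pos)
  then have "\<forall>\<^sub>F x in at_top. 0 < \<alpha> x / \<beta> x"
    by (rule order_tendstoD) simp
  then have "\<forall>\<^sub>F x in at_top. 0 < \<alpha> x"
    by (rule eventually_mono) (metis assms(3) div_0 less_irrefl order_le_less)
  then obtain x0 where "\<And>x. x0 \<le> x \<Longrightarrow> 0 < \<alpha> x"
    by (auto simp: eventually_at_top_linorder)
  then have "\<exists>x0>0. \<forall>x\<ge>x0. 0 < \<alpha> x"
    by (intro exI[of _ "max x0 1"]) auto
  moreover have "(\<lambda>x. \<alpha> (x + y)) \<sim>[at_top] \<alpha>" if "0 < y" for y
  proof -
    have "(\<lambda>x. \<alpha> (x + y)) \<sim>[at_top] (\<lambda>x. \<beta> (x + y))"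
      by (rule asymp_equiv_compose'[OF assms(4) filterlim_add_const_at_top])
    also have "\<dots> \<sim>[at_top] \<beta>"
      using assms(1) that by (simp add: long_tailed_fun_def)
    also have "\<beta> \<sim>[at_top] \<alpha>"
      by (rule asymp_equiv_symI) fact
    finally show ?thesis .
  qed
  ultimately show ?thesis
    using assms by (auto simp: long_tailed_fun_def)
qed

text \<open>
  In the split of \<open>F \<star> F\<close> by the size of the summands, the part with a moderate summand
  contributes \<open>2 * measure F {-A..A}\<close> to the ratio with \<open>F(x + \<Delta>)\<close>, which tends to \<open>2\<close> as \<open>A\<close> grows. The
  part with two large summands is at most \<open>C\<^sup>2\<close> times that of \<open>H\<close>. For \<open>H\<close> it is what remains of
  the total ratio \<open>2\<close>, namely \<open>2 - 2 * measure H {-A..A}\<close> in the limit, which tends to \<open>0\<close> as \<open>A\<close> grows.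
\<close>
lemma S_Delta_asymp_equiv:
  assumes "0 < c" "real_distribution F" "H \<in> S_Delta c" "0 \<le> C"
    and le: "\<And>B. B \<in> sets borel \<Longrightarrow> measure F B \<le> C * measure H B"
    and eq: "local_prob c H \<sim>[at_top] local_prob c F"
  shows "F \<in> S_Delta c"
proof -
  let ?f = "local_prob c F" and ?h = "local_prob c H"
  interpret F: real_distribution F by fact
  note H = S_DeltaD[OF assms(3)]
  interpret H: real_distribution H by (rule H(1))
  have lt: "long_tailed_fun ?f"
    by (rule long_tailed_asymp_equiv[OF H(2)])
       (use assms in \<open>auto intro: local_prob_measurable local_prob_nonneg asymp_equiv_symI\<close>)
  note posf = long_tailed_eventually_pos[OF lt] and posh = long_tailed_eventually_pos[OF H(2)]
  have hf: "((\<lambda>x. ?h x / ?f x) \<longlongrightarrow> 1) at_top"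
    by (rule asymp_equiv_ratio[OF eq posf])
  have "((\<lambda>x. local_prob c (F \<star> F) x / ?f x) \<longlongrightarrow> 2) at_top"
  proof (rule tendstoI)
    fix \<epsilon> :: real assume "0 < \<epsilon>"
    define K where "K = 1 + 2 * C\<^sup>2"
    define \<delta> where "\<delta> = \<epsilon> / (4 * K)"
    have "0 < K" by (simp add: K_def add_pos_nonneg)
    then have "0 < \<delta>" "\<delta> * K = \<epsilon> / 4" using \<open>0 < \<epsilon>\<close> by (simp_all add: \<delta>_def)
    then have "\<delta> * (1 + 2 * C\<^sup>2) = \<epsilon> / 4" by (simp add: K_def)
    moreover have "0 \<le> \<delta> * C\<^sup>2" using \<open>0 < \<delta>\<close> by simp
    ultimately have d1: "2 * C\<^sup>2 * \<delta> \<le> \<epsilon> / 4" "\<delta> \<le> \<epsilon> / 4"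
      using \<open>0 < \<delta>\<close> by (auto simp: algebra_simps)
    from eventually_conj[OF eventually_central_mass[OF assms(2) \<open>0 < \<delta>\<close>]
        eventually_central_mass[OF H(1) \<open>0 < \<delta>\<close>]]
    obtain A where A: "1 - \<delta> < measure F {-A..A}" "1 - \<delta> < measure H {-A..A}"
      by (auto dest: eventually_happens)
    define nF where "nF x = (LINT y:{-A..A}|F. ?f (x - y)) / ?f x" for x
    define nH where "nH x = (LINT y:{-A..A}|H. ?h (x - y)) / ?h x" for x
    have nF: "(nF \<longlongrightarrow> measure F {-A..A}) at_top" and nH: "(nH \<longlongrightarrow> measure H {-A..A}) at_top"
      unfolding nF_def nH_def using assms lt H by (intro central_integral_tendsto; simp)+
    \<comment> \<open>For \<open>2 * A \<le> x\<close> this bounds the contribution of two large summands to the ratio for \<open>F\<close>.\<close>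
    define b where "b x = C\<^sup>2 * (local_prob c (H \<star> H) x / ?h x - 2 * nH x) * (?h x / ?f x)" for x
    have "(b \<longlongrightarrow> C\<^sup>2 * (2 - 2 * measure H {-A..A}) * 1) at_top"
      unfolding b_def by (intro tendsto_intros H nH hf)
    moreover have "C\<^sup>2 * (2 - 2 * measure H {-A..A}) * 1 < \<epsilon> / 2"
    proof -
      have "C\<^sup>2 * (2 - 2 * measure H {-A..A}) \<le> C\<^sup>2 * (2 * \<delta>)"
        using A by (intro mult_left_mono) auto
      then show ?thesis using d1 \<open>0 < \<epsilon>\<close> by (simp add: mult_ac)
    qed
    ultimately have bsmall: "\<forall>\<^sub>F x in at_top. b x < \<epsilon> / 2"
      by (rule order_tendstoD)
    have "measure F {-A..A} < 1 + \<epsilon> / 4"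
      using F.prob_le_1[of "{-A..A}"] \<open>0 < \<epsilon>\<close> by linarith
    then have "\<forall>\<^sub>F x in at_top. 1 - \<delta> < nF x" "\<forall>\<^sub>F x in at_top. nF x < 1 + \<epsilon> / 4"
      using A by (auto intro!: order_tendstoD[OF nF])
    then show "\<forall>\<^sub>F x in at_top. dist (local_prob c (F \<star> F) x / ?f x) 2 < \<epsilon>"
      using bsmall posf posh eventually_ge_at_top[of "2 * A"]
    proof eventually_elim
      case (elim x)
      have sF: "local_prob c (F \<star> F) x / ?f x = 2 * nF x + far_part c A F x / ?f x"
        using convolution_square_split[OF assms(2,1), of A x] elim
        by (simp add: nF_def add_divide_distrib)
      have sH: "local_prob c (H \<star> H) x / ?h x - 2 * nH x = far_part c A H x / ?h x"
        using convolution_square_split[OF H(1) assms(1), of A x] elim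
        by (simp add: nH_def add_divide_distrib)
      have "far_part c A F x / ?f x \<le> C\<^sup>2 * far_part c A H x / ?f x"
        using far_part_mono[OF assms(2) H(1) assms(4) le] elim by (simp add: divide_right_mono)
      also have "\<dots> = b x" unfolding b_def sH using elim by simp
      finally have "far_part c A F x / ?f x \<le> b x" .
      moreover have "0 \<le> far_part c A F x / ?f x" using elim by (simp add: far_part_nonneg)
      ultimately show ?case
        using elim d1 \<open>0 < \<epsilon>\<close> unfolding sF dist_real_def by linarith
    qed
  qed
  from tendsto_mult_left[OF this, of "1/2"]
  have "((\<lambda>x. local_prob c (F \<star> F) x / (2 * ?f x)) \<longlongrightarrow> 1) at_top" by simp
  then have "local_prob c (F \<star> F) \<sim>[at_top] (\<lambda>x. 2 * ?f x)"
    by (rule asymp_equivI')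
  with lt assms(2) show ?thesis by (simp add: S_Delta_def L_Delta_def)
qed

section \<open>A contraction principle for limits\<close>

text \<open>
  The step turns \<open>\<theta>\<close> times an eventual bound, up to an arbitrarily small error, into an eventual bound,
  which makes the limit superior \<open>L\<close> of \<open>w\<close> satisfy \<open>L \<le> \<theta> * L\<close>. The proof iterates the step with an
  error chosen so that \<open>e / 2\<close> is the fixed point of the resulting affine map.
\<close>
lemma tendsto_zero_of_contraction:
  fixes w :: "'a \<Rightarrow> real"
  assumes nonneg: "\<And>x. 0 \<le> w x" and \<theta>: "0 \<le> \<theta>" "\<theta> < 1"
    and bdd: "0 \<le> B" "\<forall>\<^sub>F x in \<F>. w x \<le> B"
    and step: "\<And>D \<epsilon>. 0 \<le> D \<Longrightarrow> 0 < \<epsilon> \<Longrightarrow> \<forall>\<^sub>F x in \<F>. w x \<le> D \<Longrightarrow> \<forall>\<^sub>F x in \<F>. w x \<le> \<theta> * D + \<epsilon>"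
  shows "(w \<longlongrightarrow> 0) \<F>"
proof (rule tendstoI)
  fix e :: real assume "0 < e"
  have iter: "\<forall>\<^sub>F x in \<F>. w x \<le> e / 2 + \<theta> ^ n * B" for n
  proof (induction n)
    case 0
    from bdd(2) show ?case by (rule eventually_mono) (use \<open>0 < e\<close> in simp)
  next
    case (Suc n)
    have "0 \<le> e / 2 + \<theta> ^ n * B" using \<open>0 < e\<close> \<theta> bdd by simp
    from step[OF this _ Suc, of "(1 - \<theta>) * (e / 2)"]
    have "\<forall>\<^sub>F x in \<F>. w x \<le> \<theta> * (e / 2 + \<theta> ^ n * B) + (1 - \<theta>) * (e / 2)"
      using \<open>0 < e\<close> \<theta> by simp
    moreover have "\<theta> * (e / 2 + \<theta> ^ n * B) + (1 - \<theta>) * (e / 2) = e / 2 + \<theta> ^ Suc n * B"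
      by (simp add: field_simps)
    ultimately show ?case by simp
  qed
  have "((\<lambda>n. \<theta> ^ n * B) \<longlongrightarrow> 0 * B) sequentially"
    using \<theta> by (intro tendsto_intros LIMSEQ_power_zero) auto
  then have "\<forall>\<^sub>F n in sequentially. \<theta> ^ n * B < e / 2"
    using \<open>0 < e\<close> by (intro order_tendstoD) auto
  then obtain n where "\<theta> ^ n * B < e / 2" by (auto dest: eventually_happens)
  then show "\<forall>\<^sub>F x in \<F>. dist (w x) 0 < e"
    using iter[of n] nonneg by (auto elim!: eventually_mono)
qed

section \<open>Convolution with a mixture\<close>

lemma convolution_mixture:
  fixes p q :: real
  assumes "real_distribution F" "real_distribution G" "real_distribution G\<^sub>1" "0 \<le> p" "0 \<le> q"
    and mix: "\<And>B. B \<in> sets borel \<Longrightarrow> measure G B = p * measure (return borel 0) B + q * measure G\<^sub>1 B"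
    and B: "B \<in> sets borel"
  shows "measure (G \<star> F) B = p * measure F B + q * measure (G\<^sub>1 \<star> F) B"
proof -
  interpret F: real_distribution F by fact
  interpret G: real_distribution G by fact
  interpret G1: real_distribution G\<^sub>1 by fact
  interpret R: prob_space "return borel (0::real)" by (rule prob_space_return) simp
  interpret GF: real_distribution "G \<star> F" by (rule real_distribution_convolution) fact+
  interpret G1F: real_distribution "G\<^sub>1 \<star> F" by (rule real_distribution_convolution) fact+
  have [measurable]: "B \<in> sets borel" by fact
  have emix: "emeasure G B = ennreal p * emeasure (return borel 0) B + ennreal q * emeasure G\<^sub>1 B"
    if "B \<in> sets borel" for B
    unfolding G.emeasure_eq_measure G1.emeasure_eq_measure R.emeasure_eq_measure mix[OF that]
    using assms(4,5) by (simp add: ennreal_mult ennreal_plus)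
  \<comment> \<open>The identity of measures extends from indicator functions to all non-negative integrands.\<close>
  have int: "(\<integral>\<^sup>+u. \<phi> u \<partial>G) = ennreal p * \<phi> 0 + ennreal q * (\<integral>\<^sup>+u. \<phi> u \<partial>G\<^sub>1)"
    if "\<phi> \<in> borel_measurable borel" for \<phi>
    using that
  proof induction
    case (cong f g)
    then show ?case by (metis UNIV_I ext space_borel)
  next
    case (set A)
    then show ?case using emix[OF set] by (simp add: emeasure_return)
  next
    case (mult u r)
    then show ?case by (simp add: nn_integral_cmult distrib_left mult_ac)
  next
    case (add u v)
    then show ?case by (simp add: nn_integral_add distrib_left add_ac)
  next
    case (seq U)
    have "(\<integral>\<^sup>+u. (SUP i. U i) u \<partial>G) = (SUP i. ennreal p * U i 0 + ennreal q * (\<integral>\<^sup>+u. U i u \<partial>G\<^sub>1))"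
      using seq by (simp add: image_comp nn_integral_monotone_convergence_SUP)
    also have "\<dots> = (SUP i. ennreal p * U i 0) + (SUP i. ennreal q * (\<integral>\<^sup>+u. U i u \<partial>G\<^sub>1))"
      using seq(3) by (intro ennreal_SUP_add)
        (auto simp: incseq_def le_fun_def intro!: mult_left_mono nn_integral_mono)
    also have "\<dots> = ennreal p * (SUP i. U i) 0 + ennreal q * (\<integral>\<^sup>+u. (SUP i. U i) u \<partial>G\<^sub>1)"
      using seq by (simp add: image_comp nn_integral_monotone_convergence_SUP SUP_mult_left_ennreal)
    finally show ?case .
  qed
  let ?\<phi> = "\<lambda>u. \<integral>\<^sup>+y. indicator B (u + y) \<partial>F"
  have "emeasure (G \<star> F) B = (\<integral>\<^sup>+u. ?\<phi> u \<partial>G)"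
    by (rule convolution_emeasure') (auto intro: G.finite_measure_axioms F.finite_measure_axioms)
  also have "\<dots> = ennreal p * ?\<phi> 0 + ennreal q * (\<integral>\<^sup>+u. ?\<phi> u \<partial>G\<^sub>1)"
    by (rule int) measurable
  also have "?\<phi> 0 = emeasure F B" by simp
  also have "(\<integral>\<^sup>+u. ?\<phi> u \<partial>G\<^sub>1) = emeasure (G\<^sub>1 \<star> F) B"
    by (rule convolution_emeasure'[symmetric]) (auto intro: G1.finite_measure_axioms F.finite_measure_axioms)
  finally have "ennreal (measure (G \<star> F) B) = ennreal (p * measure F B + q * measure (G\<^sub>1 \<star> F) B)"
    using assms(4,5)
    by (simp add: GF.emeasure_eq_measure F.emeasure_eq_measure G1F.emeasure_eq_measure ennreal_mult ennreal_plus)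
  then show ?thesis
    using assms(4,5) by (subst (asm) ennreal_inj) auto
qed

section \<open>Contribution of large summands\<close>

text \<open>
  Beyond a large \<open>A\<close>, the measure \<open>M\<close> is at most \<open>\<epsilon> / 7\<close> times \<open>H\<close> on windows of length \<open>c\<close>, so the
  comparison on cells bounds the integral by \<open>\<epsilon> / 7\<close> times the mass that \<open>H \<star> H\<close> gives to three
  adjacent windows near \<open>x\<close>. By subexponentiality each of these masses is asymptotically
  \<open>2 * H(x + \<Delta>)\<close>, and \<open>2 + 2 + 2 < 7\<close>.
\<close>
lemma right_tail_small:
  assumes "0 < c" "H \<in> S_Delta c" "real_distribution M"
    and small: "local_prob c M \<in> o[at_top](local_prob c H)" and "0 < \<epsilon>"
  shows "\<forall>\<^sub>F A in at_top. \<forall>\<^sub>F x in at_top.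
           (LINT y:{A<..}|M. local_prob c H (x - y)) \<le> \<epsilon> * local_prob c H x"
proof -
  let ?h = "local_prob c H" and ?h2 = "local_prob c (H \<star> H)"
  note H = S_DeltaD[OF assms(2)]
  note posh = long_tailed_eventually_pos[OF H(2)]
  have shift2: "((\<lambda>x. ?h2 (x + d) / ?h x) \<longlongrightarrow> 2) at_top" for d
  proof -
    have "((\<lambda>x. ?h2 (x + d) / ?h (x + d) * (?h (x + d) / ?h x)) \<longlongrightarrow> 2 * 1) at_top"
      by (intro tendsto_mult filterlim_compose[OF H(3) filterlim_add_const_at_top] long_tailed_shift H)
    moreover have "\<forall>\<^sub>F x in at_top. ?h2 (x + d) / ?h (x + d) * (?h (x + d) / ?h x) = ?h2 (x + d) / ?h x"
      using eventually_compose_filterlim[OF posh filterlim_add_const_at_top[where d = d]] by eventually_elim simp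
    ultimately show ?thesis using Lim_transform_eventually by fastforce
  qed
  have three: "local_prob (3 * c) (H \<star> H) (x - c) = ?h2 (x + - c) + ?h2 (x + 0) + ?h2 (x + c)" for x
  proof -
    have "real_distribution (H \<star> H)" by (intro real_distribution_convolution H)
    then show ?thesis
      using local_prob_add[of "H \<star> H" c "2 * c" "x - c"] local_prob_add[of "H \<star> H" c c x] \<open>0 < c\<close>
      by simp
  qed
  have "((\<lambda>x. ?h2 (x + - c) / ?h x + ?h2 (x + 0) / ?h x + ?h2 (x + c) / ?h x) \<longlongrightarrow> 2 + 2 + 2) at_top"
    by (intro tendsto_add shift2)
  then have seven: "\<forall>\<^sub>F x in at_top. ?h2 (x + - c) / ?h x + ?h2 (x + 0) / ?h x + ?h2 (x + c) / ?h x < 7"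
    by (rule order_tendstoD) simp
  have "\<forall>\<^sub>F t in at_top. norm (local_prob c M t) \<le> \<epsilon> / 7 * norm (?h t)"
    using small \<open>0 < \<epsilon>\<close> by (intro landau_o.smallD) auto
  then obtain A0 where A0: "\<And>t. A0 \<le> t \<Longrightarrow> local_prob c M t \<le> \<epsilon> / 7 * ?h t"
    by (auto simp: eventually_at_top_linorder local_prob_nonneg)
  show ?thesis
    using eventually_ge_at_top[of A0]
  proof eventually_elim
    case (elim A)
    from seven posh show ?case
    proof eventually_elim
      case x: (elim x)
      have "(LINT y:{A<..}|M. ?h (x - y)) \<le> \<epsilon> / 7 * local_prob (3 * c) (H \<star> H) (x - c)"
        using A0 elim \<open>0 < \<epsilon>\<close> by (intro cell_comparison assms H) auto
      also have "\<dots> \<le> \<epsilon> / 7 * (7 * ?h x)"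
        using x \<open>0 < \<epsilon>\<close> unfolding three
        by (intro mult_left_mono) (auto simp: field_simps simp flip: add_divide_distrib)
      finally show ?case by simp
    qed
  qed
qed

text \<open>
  A very negative summand forces the other one beyond \<open>x\<close>. Almost monotonicity
  bounds the mass of windows far to the right of \<open>x\<close> by that of \<open>(x, x + c]\<close>, which leaves the small
  factor \<open>measure M {..<-A}\<close>; for \<open>M\<close> on the half-line there is no such summand.
\<close>
lemma left_tail_small:
  assumes "0 < c" "real_distribution H" "real_distribution M"
    and or: "almost_decreasing (local_prob c H) \<or> measure M {0..} = 1" and "0 < \<epsilon>"
  shows "\<forall>\<^sub>F A in at_top. \<forall>\<^sub>F x in at_top.
           (LINT y:{..<-A}|M. local_prob c H (x - y)) \<le> \<epsilon> * local_prob c H x"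
proof -
  let ?h = "local_prob c H"
  interpret M: real_distribution M by fact
  have lower: "measure M {..<-A} \<le> 1 - measure M {-A..A}" for A
  proof -
    have "measure M {..<-A} \<le> measure M (space M - {-A..A})"
      by (intro M.finite_measure_mono) auto
    then show ?thesis using M.prob_compl[of "{-A..A}"] by simp
  qed
  have bound: "(LINT y:{..<-A}|M. ?h (x - y)) \<le> K * ?h x * measure M {..<-A}"
    if "\<And>y. y < - A \<Longrightarrow> ?h (x - y) \<le> K * ?h x" for A x K
  proof -
    have "(LINT y:{..<-A}|M. ?h (x - y)) \<le> (LINT y:{..<-A}|M. K * ?h x)"
      using that by (intro set_integral_mono set_integrable_local_prob assms)
        (auto simp: set_integrable_def less_top[symmetric])
    then show ?thesis by (simp add: set_lebesgue_integral_def mult_ac)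
  qed
  show ?thesis
    using or
  proof
    assume "almost_decreasing ?h"
    then obtain x0 K where K: "0 < K" "\<And>x y. x0 < x \<Longrightarrow> 0 < y \<Longrightarrow> ?h (x + y) \<le> K * ?h x"
      unfolding almost_decreasing_def by blast
    have "\<forall>\<^sub>F A in at_top. 1 - \<epsilon> / K < measure M {-A..A}"
      using K \<open>0 < \<epsilon>\<close> by (intro eventually_central_mass assms) simp
    then show ?thesis
      using eventually_ge_at_top[of 0]
    proof eventually_elim
      case (elim A)
      have m: "K * measure M {..<-A} \<le> \<epsilon>"
      proof -
        have "measure M {..<-A} \<le> \<epsilon> / K" using lower[of A] elim by linarith
        then show ?thesis using K(1) by (simp add: field_simps)
      qed
      show ?case
        using eventually_gt_at_top[of x0]
      proof eventually_elim
        case x: (elim x)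
        have "(LINT y:{..<-A}|M. ?h (x - y)) \<le> K * ?h x * measure M {..<-A}"
          using K(2)[of x "- y" for y] x elim by (intro bound) auto
        also have "\<dots> = K * measure M {..<-A} * ?h x" by simp
        also have "\<dots> \<le> \<epsilon> * ?h x"
          by (intro mult_right_mono m local_prob_nonneg)
        finally show ?case .
      qed
    qed
  next
    assume one: "measure M {0..} = 1"
    have null: "measure M {..<-A} = 0" if "0 \<le> A" for A
    proof -
      have "measure M {..<-A} \<le> measure M (space M - {0..})"
        using that by (intro M.finite_measure_mono) auto
      then show ?thesis using one M.prob_compl[of "{0..}"] by (simp add: measure_le_0_iff)
    qed
    show ?thesis
      using eventually_ge_at_top[of 0]
    proof eventually_elim
      case (elim A)
      have "AE y in M. y \<notin> {..<-A}"
        using null[OF elim] by (intro AE_not_in) (auto simp: null_sets_def M.emeasure_eq_measure)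
      then have "(LINT y:{..<-A}|M. ?h (x - y)) = 0" for x
        unfolding set_lebesgue_integral_def
        by (intro integral_eq_zero_AE) (auto elim!: eventually_mono)
      then show ?case using \<open>0 < \<epsilon>\<close> by (simp add: local_prob_nonneg)
    qed
  qed
qed

lemma set_integral_local_prob_split:
  assumes "real_distribution M" "real_distribution N" "0 < c" "0 \<le> A"
  shows "(LINT y:UNIV|M. local_prob c N (x - y)) =
         (LINT y:{-A..A}|M. local_prob c N (x - y)) +
         ((LINT y:{..<-A}|M. local_prob c N (x - y)) + (LINT y:{A<..}|M. local_prob c N (x - y)))"
proof -
  note int = set_integrable_local_prob[OF assms(1-3)]
  have "UNIV = {-A..A} \<union> ({..<-A} \<union> {A<..})" by auto
  then have "(LINT y:UNIV|M. local_prob c N (x - y)) =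
      (LINT y:{-A..A} \<union> ({..<-A} \<union> {A<..})|M. local_prob c N (x - y))" by simp
  also have "\<dots> = (LINT y:{-A..A}|M. local_prob c N (x - y)) +
      (LINT y:{..<-A} \<union> {A<..}|M. local_prob c N (x - y))"
    by (intro set_integral_Un int) auto
  also have "(LINT y:{..<-A} \<union> {A<..}|M. local_prob c N (x - y)) =
      (LINT y:{..<-A}|M. local_prob c N (x - y)) + (LINT y:{A<..}|M. local_prob c N (x - y))"
    using assms(4) by (intro set_integral_Un int) auto
  finally show ?thesis .
qed

text \<open>
  Adding an independent summand with law \<open>M\<close> essentially does not increase the relative distance
  \<open>D\<close> between \<open>F(x + \<Delta>)\<close> and \<open>H(x + \<Delta>)\<close>. A moderate summand only averages this distance
  over nearby points, and the large summands are negligible for \<open>H\<close>, hence also for the dominated \<open>F\<close>.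
\<close>
lemma convolution_relative_error:
  assumes "0 < c" "H \<in> S_Delta c" "real_distribution F" "real_distribution M"
    and small: "local_prob c M \<in> o[at_top](local_prob c H)"
    and or: "almost_decreasing (local_prob c H) \<or> measure M {0..} = 1"
    and "0 \<le> C" and le: "\<And>x. local_prob c F x \<le> C * local_prob c H x"
    and "0 \<le> D" and err: "\<forall>\<^sub>F x in at_top. \<bar>local_prob c F x - local_prob c H x\<bar> \<le> D * local_prob c H x"
    and "0 < \<epsilon>"
  shows "\<forall>\<^sub>F x in at_top. \<bar>local_prob c (M \<star> F) x - local_prob c H x\<bar> \<le> (D + \<epsilon>) * local_prob c H x"
proof -
  let ?f = "local_prob c F" and ?h = "local_prob c H"
  note H = S_DeltaD[OF assms(2)]
  interpret M: real_distribution M by fact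
  \<comment> \<open>The errors below add up to \<open>\<delta> * (D + 1 + 2 * C)\<close>, which is at most \<open>\<epsilon>\<close> for \<open>\<delta> = \<epsilon> / K\<close>.\<close>
  define K where "K = D + 2 + 2 * C"
  define \<delta> where "\<delta> = \<epsilon> / K"
  have "0 < K" using \<open>0 \<le> C\<close> \<open>0 \<le> D\<close> by (simp add: K_def)
  then have "0 < \<delta>" and "\<delta> * K = \<epsilon>" using \<open>0 < \<epsilon>\<close> by (simp_all add: \<delta>_def)
  have "\<forall>\<^sub>F A in at_top. 0 \<le> A \<and> 1 - \<delta> < measure M {-A..A} \<and>
      (\<forall>\<^sub>F x in at_top. (LINT y:{..<-A}|M. ?h (x - y)) \<le> \<delta> * ?h x) \<and>
      (\<forall>\<^sub>F x in at_top. (LINT y:{A<..}|M. ?h (x - y)) \<le> \<delta> * ?h x)"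
    by (intro eventually_conj eventually_ge_at_top eventually_central_mass
        left_tail_small right_tail_small assms H \<open>0 < \<delta>\<close>)
  then obtain A where A: "0 \<le> A" "1 - \<delta> < measure M {-A..A}"
    and left: "\<forall>\<^sub>F x in at_top. (LINT y:{..<-A}|M. ?h (x - y)) \<le> \<delta> * ?h x"
    and right: "\<forall>\<^sub>F x in at_top. (LINT y:{A<..}|M. ?h (x - y)) \<le> \<delta> * ?h x"
    by (auto dest: eventually_happens)
  define m where "m = measure M {-A..A}"
  have m: "1 - \<delta> < m" "m \<le> 1" using A by (simp_all add: m_def)
  define near where "near x = (LINT y:{-A..A}|M. ?h (x - y))" for x
  have near: "((\<lambda>x. near x / ?h x) \<longlongrightarrow> m) at_top"
    unfolding near_def m_def by (intro central_integral_tendsto assms H)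
  have near_lo: "\<forall>\<^sub>F x in at_top. 1 - \<delta> < near x / ?h x"
    by (rule order_tendstoD[OF near]) (use m in simp)
  have near_up: "\<forall>\<^sub>F x in at_top. near x / ?h x < 1 + \<delta>"
    by (rule order_tendstoD[OF near]) (use m \<open>0 < \<delta>\<close> in simp)
  have intF: "set_integrable M S (\<lambda>y. ?f (x - y))" and intH: "set_integrable M S (\<lambda>y. ?h (x - y))"
    if "S \<in> sets borel" for S x
    using that assms H by (auto intro!: set_integrable_local_prob)
  have tail: "0 \<le> (LINT y:S|M. ?f (x - y)) \<and> (LINT y:S|M. ?f (x - y)) \<le> C * (LINT y:S|M. ?h (x - y))"
    if [measurable]: "S \<in> sets borel" for S x
  proof
    show "0 \<le> (LINT y:S|M. ?f (x - y))"
      unfolding set_lebesgue_integral_def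
      by (intro Bochner_Integration.integral_nonneg) (simp add: local_prob_nonneg)
    have "(LINT y:S|M. ?f (x - y)) \<le> (LINT y:S|M. C * ?h (x - y))"
      using le by (intro set_integral_mono intF set_integrable_mult_right intH that) auto
    then show "(LINT y:S|M. ?f (x - y)) \<le> C * (LINT y:S|M. ?h (x - y))" by simp
  qed
  obtain x0 where x0: "\<And>x. x0 \<le> x \<Longrightarrow> \<bar>?f x - ?h x\<bar> \<le> D * ?h x"
    using err by (auto simp: eventually_at_top_linorder)
  show ?thesis
    using left right near_lo near_up long_tailed_eventually_pos[OF H(2)] eventually_ge_at_top[of "x0 + A"]
  proof eventually_elim
    case (elim x)
    define nf where "nf = (LINT y:{-A..A}|M. ?f (x - y))"
    define tf where "tf = (LINT y:{..<-A}|M. ?f (x - y)) + (LINT y:{A<..}|M. ?f (x - y))"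
    have split: "local_prob c (M \<star> F) x = nf + tf"
      using set_integral_local_prob_split[OF assms(4,3,1) A(1), of x] assms
      by (simp add: local_prob_convolution nf_def tf_def)
    have nearx: "(1 - \<delta>) * ?h x \<le> near x" "near x \<le> (1 + \<delta>) * ?h x"
      using elim by (simp_all add: field_simps)
    have "nf \<le> (LINT y:{-A..A}|M. (1 + D) * ?h (x - y))"
      unfolding nf_def
    proof (intro set_integral_mono intF set_integrable_mult_right intH)
      fix y assume "y \<in> {-A..A}"
      then have "x0 \<le> x - y" using elim by simp
      from x0[OF this] show "?f (x - y) \<le> (1 + D) * ?h (x - y)" by (simp add: algebra_simps)
    qed auto
    then have "nf \<le> (1 + D) * near x" by (simp only: set_integral_mult_right near_def)
    then have up: "nf - near x \<le> D * near x" by (simp add: algebra_simps)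
    have "(LINT y:{-A..A}|M. (1 - D) * ?h (x - y)) \<le> nf"
      unfolding nf_def
    proof (intro set_integral_mono intF set_integrable_mult_right intH)
      fix y assume "y \<in> {-A..A}"
      then have "x0 \<le> x - y" using elim by simp
      from x0[OF this] show "(1 - D) * ?h (x - y) \<le> ?f (x - y)" by (simp add: algebra_simps)
    qed auto
    then have "(1 - D) * near x \<le> nf" by (simp only: set_integral_mult_right near_def)
    then have lo: "- (D * near x) \<le> nf - near x" by (simp add: algebra_simps)
    have Dnear: "D * near x \<le> D * ((1 + \<delta>) * ?h x)"
      using nearx \<open>0 \<le> D\<close> by (intro mult_left_mono)
    have "(LINT y:{..<-A}|M. ?f (x - y)) \<le> C * (\<delta> * ?h x)" "(LINT y:{A<..}|M. ?f (x - y)) \<le> C * (\<delta> * ?h x)"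
      using tail[of "{..<-A}" x] tail[of "{A<..}" x] elim(1,2) \<open>0 \<le> C\<close>
      by (auto intro: order_trans mult_left_mono)
    then have tf: "0 \<le> tf" "tf \<le> 2 * C * \<delta> * ?h x"
      using tail[of "{..<-A}" x] tail[of "{A<..}" x] by (auto simp: tf_def)
    have "\<bar>nf + tf - ?h x\<bar> \<le> D * near x + \<delta> * ?h x + 2 * C * \<delta> * ?h x"
      using up lo nearx tf by (simp add: algebra_simps abs_le_iff)
    also have "\<dots> \<le> D * ((1 + \<delta>) * ?h x) + \<delta> * ?h x + 2 * C * \<delta> * ?h x"
      using Dnear by simp
    also have "\<dots> = (D + \<delta> * (D + 1 + 2 * C)) * ?h x"
      by (simp add: algebra_simps)
    also have "\<dots> \<le> (D + \<epsilon>) * ?h x"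
      using elim \<open>0 < \<delta>\<close> \<open>\<delta> * K = \<epsilon>\<close> by (intro mult_right_mono) (auto simp: K_def algebra_simps)
    finally show ?case by (simp add: split)
  qed
qed

section \<open>Deconvolution of a mixture with a dominant atom\<close>

theorem proposition3p11:
  fixes c p\<^sub>G :: real and F G G\<^sub>1 H :: "real measure"
  assumes "c > 0"
    and "real_distribution F" and "real_distribution G" and "real_distribution G\<^sub>1"
    and "H = (G \<star> F)" and "H \<in> S_Delta c"
    and "1 / 2 < p\<^sub>G" and "p\<^sub>G < 1"
    and "\<And>A. A \<in> sets borel \<Longrightarrow>
           measure G A = p\<^sub>G * measure (return borel 0) A + (1 - p\<^sub>G) * measure G\<^sub>1 A"
    and "H \<in> D_Delta c \<or>
         (measure F {0..} = 1 \<and> measure G {0..} = 1 \<and> measure H {0..} = 1)"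
    and "local_prob c G \<in> o[at_top](local_prob c H)"
  shows "F \<in> S_Delta c \<and> local_prob c H \<sim>[at_top] local_prob c F"
proof -
  define q where "q = 1 - p\<^sub>G"
  have q: "0 < q" "q < p\<^sub>G" "0 < p\<^sub>G" "p\<^sub>G + q = 1" using assms(7,8) by (auto simp: q_def)
  let ?f = "local_prob c F" and ?h = "local_prob c H" and ?k = "local_prob c (G\<^sub>1 \<star> F)"
  note H = S_DeltaD[OF \<open>H \<in> S_Delta c\<close>]
  note mix = assms(9)[folded q_def]
  have Hmix: "measure H B = p\<^sub>G * measure F B + q * measure (G\<^sub>1 \<star> F) B" if "B \<in> sets borel" for B
    unfolding \<open>H = (G \<star> F)\<close> using q by (intro convolution_mixture assms mix that) auto
  have FH: "measure F B \<le> 1 / p\<^sub>G * measure H B" if "B \<in> sets borel" for B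
    using Hmix[OF that] q by (simp add: field_simps)
  have hfk: "?h x = p\<^sub>G * ?f x + q * ?k x" for x
    by (simp add: local_prob_def Hmix)
  have fh: "?f x \<le> 1 / p\<^sub>G * ?h x" for x
    unfolding local_prob_def by (rule FH) simp
  \<comment> \<open>The atom at \<open>0\<close> lies outside \<open>(x, x + c]\<close> once \<open>x \<ge> 0\<close>.\<close>
  have "local_prob c G\<^sub>1 \<in> O[at_top](local_prob c G)"
  proof (rule bigoI)
    show "\<forall>\<^sub>F x in at_top. norm (local_prob c G\<^sub>1 x) \<le> 1 / q * norm (local_prob c G x)"
      using eventually_ge_at_top[of 0]
      by eventually_elim (use q in \<open>simp add: local_prob_def mix measure_return\<close>)
  qed
  then have small: "local_prob c G\<^sub>1 \<in> o[at_top](?h)"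
    using assms(11) by (rule landau_o.big_small_trans)
  have or: "almost_decreasing ?h \<or> measure G\<^sub>1 {0..} = 1"
    using assms(10)
  proof
    assume "measure F {0..} = 1 \<and> measure G {0..} = 1 \<and> measure H {0..} = 1"
    then have "1 = p\<^sub>G + q * measure G\<^sub>1 {0..}"
      using mix[of "{0..}"] by (simp add: measure_return)
    then have "q * measure G\<^sub>1 {0..} = q * 1" using q by linarith
    then show ?thesis using q by simp
  qed (simp add: D_Delta_def)
  define w where "w x = \<bar>?f x / ?h x - 1\<bar>" for x
  note pos = long_tailed_eventually_pos[OF H(2)]
  have "(w \<longlongrightarrow> 0) at_top"
  proof (rule tendsto_zero_of_contraction[where \<theta> = "q / p\<^sub>G" and B = "1 / p\<^sub>G + 1"])
    show "\<forall>\<^sub>F x in at_top. w x \<le> 1 / p\<^sub>G + 1"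
      using pos
    proof eventually_elim
      case (elim x)
      then have "0 \<le> ?f x / ?h x" "?f x / ?h x \<le> 1 / p\<^sub>G"
        using fh[of x] by (auto simp: local_prob_nonneg divide_le_eq)
      then show ?case unfolding w_def by linarith
    qed
  next
    fix D \<epsilon> :: real assume "0 \<le> D" "0 < \<epsilon>" and wD: "\<forall>\<^sub>F x in at_top. w x \<le> D"
    have "\<forall>\<^sub>F x in at_top. \<bar>?f x - ?h x\<bar> \<le> D * ?h x"
      using wD pos
    proof eventually_elim
      case (elim x)
      have "\<bar>?f x - ?h x\<bar> = w x * ?h x"
        using elim by (simp add: w_def field_simps flip: abs_mult_pos)
      then show ?case using elim by simp
    qed
    then have "\<forall>\<^sub>F x in at_top. \<bar>?k x - ?h x\<bar> \<le> (D + \<epsilon>) * ?h x"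
      using q by (intro convolution_relative_error[OF _ _ _ _ small or _ fh] assms \<open>0 \<le> D\<close> \<open>0 < \<epsilon>\<close>) auto
    then show "\<forall>\<^sub>F x in at_top. w x \<le> q / p\<^sub>G * D + \<epsilon>"
      using pos
    proof eventually_elim
      case (elim x)
      \<comment> \<open>As \<open>p\<^sub>G + q = 1\<close>, \<open>f / h\<close> deviates from \<open>1\<close> by \<open>- q / p\<^sub>G\<close> times
      the deviation of \<open>k / h\<close>.\<close>
      have "p\<^sub>G * ?f x - p\<^sub>G * ?h x = q * (?h x - ?k x)"
      proof -
        have "(p\<^sub>G + q) * ?h x = ?h x" using q by simp
        then show ?thesis using hfk[of x] unfolding distrib_right right_diff_distrib by linarith
      qed
      moreover have "?f x / ?h x - 1 = (p\<^sub>G * ?f x - p\<^sub>G * ?h x) / (p\<^sub>G * ?h x)"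
        using elim q by (simp add: field_simps)
      ultimately have "?f x / ?h x - 1 = q / p\<^sub>G * ((?h x - ?k x) / ?h x)"
        by simp
      then have "w x = q / p\<^sub>G * (\<bar>?k x - ?h x\<bar> / ?h x)"
        using elim q unfolding w_def by (simp add: abs_mult abs_divide abs_minus_commute)
      also have "\<dots> \<le> q / p\<^sub>G * (D + \<epsilon>)"
        using elim q by (intro mult_left_mono) (auto simp: divide_le_eq)
      also have "\<dots> \<le> q / p\<^sub>G * D + \<epsilon>"
        using q \<open>0 < \<epsilon>\<close> by (simp add: distrib_left divide_le_eq)
      finally show ?case .
    qed
  qed (use q in \<open>auto simp: w_def\<close>)
  then have "((\<lambda>x. ?f x / ?h x - 1) \<longlongrightarrow> 0) at_top"
    unfolding w_def by (simp only: tendsto_rabs_zero_iff)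
  then have "((\<lambda>x. ?f x / ?h x) \<longlongrightarrow> 1) at_top"
    by (rule LIM_zero_cancel)
  then have "?h \<sim>[at_top] ?f"
    by (rule asymp_equiv_symI[OF asymp_equivI'])
  moreover from this have "F \<in> S_Delta c"
    using q by (intro S_Delta_asymp_equiv[where C = "1 / p\<^sub>G", OF assms(1,2,6) _ FH]) auto
  ultimately show ?thesis by simp
qed

end
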